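(* Let $\lambda=(\lambda_1,\ldots,\lambda_\ell)$ with $\lambda_1>\lambda_2>\cdots>\lambda_\ell>0$ be a partition of $n$ with distinct parts, with shifted diagram $[\lambda]^*$, shifted hook lengths $h^*_{ij}$ and set of shifted corners $\mathcal C^*[\lambda]$ (defined in the context), and use the convention $h^*_{\mathbf z}=1$ if $\mathbf z\notin[\lambda]^*$. Then the following three equalities hold: \[ n\cdot \prod_{(i,j)\in[\lambda]^*\setminus \mathcal C^*[\lambda]}(h^*_{ij}-1)=\sum_{(r,s)\in \mathcal C^*[\lambda]}\ \prod_{\substack{(i,j)\in[\lambda]^*\setminus \mathcal C^*[\lambda]\\ i\neq r,\ j\neq r-1,\ j\neq s}}(h^*_{ij}-1)\ \prod_{i=1}^{r-1}h^*_{is}\prod_{j=r}^{s-1}h^*_{rj}\prod_{i=1}^{r-1}h^*_{i,r-1}, \] \[ \lambda_1\cdot \prod_{(i,j)\in[\lambda]^*\setminus \mathcal C^*[\lambda]}(h^*_{ij}-1)=\sum_{(r,s)\in \mathcal C^*[\lambda]}\left(h^*_{1,r-1}+h^*_{1s}-1\right)\prod_{\substack{(i,j)\in[\lambda]^*\setminus \mathcal C^*[\lambda]\\ i\neq r,\ j\neq r-1,\ j\neq s}}(h^*_{ij}-1)\ \prod_{i=2}^{r-1}h^*_{is}\prod_{j=r}^{s-1}h^*_{rj}\prod_{i=2}^{r-1}h^*_{i,r-1}, \] \[ \prod_{(i,j)\in[\lambda]^*\setminus \mathcal C^*[\lambda]}(h^*_{ij}-1)=\sum_{(r,s)\in \mathcal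 C^*[\lambda]}\left(h^*_{1s}h^*_{2,r-1}+(h^*_{1,r-1}-1)(h^*_{2s}-1)\right)\prod_{\substack{(i,j)\in[\lambda]^*\setminus \mathcal C^*[\lambda]\\ i\neq r,\ j\neq r-1,\ j\neq s}}(h^*_{ij}-1)\ \prod_{i=3}^{r-1}h^*_{is}\prod_{j=\max\{r,2\}}^{s-1}h^*_{rj}\prod_{i=3}^{r-1}h^*_{i,r-1}. \] Here empty products equal $1$.
   Context: For a partition $\lambda=(\lambda_1>\cdots>\lambda_\ell>0)$ with distinct parts, the shifted diagram is $[\lambda]^*=\{(i,j)\in\mathbb Z^2: 1\le i\le \ell,\ i\le j\le \lambda_i+i-1\}$ (row $i$, column $j$). The hook $H^*_{ij}$ of $(i,j)\in[\lambda]^*$ is the set of squares of $[\lambda]^*$ of the form $(i,j')$ with $j'\ge j$, or $(i',j)$ with $i'>i$, or $(j+1,j')$ with $j'\ge j+1$; the hook length is $h^*_{ij}=|H^*_{ij}|$ (equivalently $h^*_{ij}=\lambda_i+\lambda_{j+1}$ if $j<\ell$, and $h^*_{ij}=\lambda_i+\max\{k:\lambda_k\ge j+1-k\ge 1\}-j$ if $j\ge \ell$). A shifted corner is a square $(i,j)\in[\lambda]^*$ with $(i+1,j)\notin[\lambda]^*$ and $(i,j+1)\notin[\lambda]^*$; $\mathcal C^*[\lambda]$ denotes the set of shifted corners. *)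

theory Defs
  imports Main
begin

text \<open>A nonempty partition of \<open>n\<close> into distinct parts, as the strictly decreasing list
  of its parts. The empty partition is excluded, since a first part is presupposed throughout.\<close>

definition strict_partition :: "nat list \<Rightarrow> nat \<Rightarrow> bool" where
  "strict_partition lam n \<longleftrightarrow>
     lam \<noteq> [] \<and> sorted_wrt (>) lam \<and> (\<forall>k\<in>set lam. 0 < k) \<and> sum_list lam = n"

text \<open>Parts, rows and columns are numbered from 1; the value at index 0 is never used.\<close>

definition part :: "nat list \<Rightarrow> nat \<Rightarrow> nat" where
  "part lam i = lam ! (i - 1)"

definition shifted_diagram :: "nat list \<Rightarrow> (nat \<times> nat) set" where
  "shifted_diagram lam = {(i, j). 1 \<le> i \<and> i \<le> length lam \<and> i \<le> j \<and> j \<le> part lam i + i - 1}"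

definition shifted_hook :: "nat list \<Rightarrow> nat \<Rightarrow> nat \<Rightarrow> (nat \<times> nat) set" where
  "shifted_hook lam i j =
     {(i', j') \<in> shifted_diagram lam.
        (i' = i \<and> j \<le> j') \<or> (i < i' \<and> j' = j) \<or> (i' = j + 1 \<and> j + 1 \<le> j')}"

text \<open>The hook length is an integer, so that subtracting from it does not truncate, and
  it is 1 outside the diagram by convention.\<close>

definition shifted_hook_length :: "nat list \<Rightarrow> nat \<Rightarrow> nat \<Rightarrow> int" where
  "shifted_hook_length lam i j =
     (if (i, j) \<in> shifted_diagram lam then int (card (shifted_hook lam i j)) else 1)"

definition shifted_corners :: "nat list \<Rightarrow> (nat \<times> nat) set" where
  "shifted_corners lam =
     {(i, j) \<in> shifted_diagram lam.
        (i + 1, j) \<notin> shifted_diagram lam \<and> (i, j + 1) \<notin> shifted_diagram lam}"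

end

theory Submission
  imports Defs "HOL-Computational_Algebra.Polynomial" "HOL.Rat"
begin

text \<open>
  Write \<open>x\<^sub>i\<close> for the parts, \<open>a\<^sub>i = x\<^sub>i (x\<^sub>i - 1)\<close> and \<open>b\<^sub>i = x\<^sub>i (x\<^sub>i + 1)\<close>. Divide by the product
  on the left-hand side. The quotient of the term of a corner in row \<open>r\<close> is a product of factors
  \<open>h / (h - 1)\<close>. Above the corner \<open>h = x\<^sub>i - x\<^sub>r + 1\<close>, in column \<open>r - 1\<close> we have \<open>h = x\<^sub>i + x\<^sub>r\<close>, and in
  row \<open>r\<close> the hook lengths that are not of the form \<open>x\<^sub>r + x\<^sub>i\<close> complement the differences
  \<open>x\<^sub>r - x\<^sub>i\<close> in \<open>{1..x\<^sub>r}\<close>, so everything collapses to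
  \<open>x\<^sub>r \<Prod>\<^sub>i (a\<^sub>r - b\<^sub>i) / (a\<^sub>r - a\<^sub>i)\<close>, the product over all \<open>i \<noteq> r\<close>. This expression vanishes when row
  \<open>r\<close> has no corner, because then \<open>b\<^sub>r\<^sub>+\<^sub>1 = a\<^sub>r\<close>, so one may sum over all rows. As
  \<open>a\<^sub>r - b\<^sub>r = - 2 x\<^sub>r\<close>, each of the three sums is a Lagrange interpolation sum
  \<open>\<Sum>\<^sub>r P(a\<^sub>r) / \<Prod>\<^sub>i (a\<^sub>r - a\<^sub>i)\<close>, whose value is a coefficient of \<open>P\<close>: up to constant factors, \<open>P\<close> is
  \<open>\<Prod>\<^sub>i (X - b\<^sub>i)\<close> (minus \<open>\<Prod>\<^sub>i (X - a\<^sub>i)\<close>, which does not affect the values at the \<open>a\<^sub>r\<close> but lowers the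
  degree), then \<open>\<Prod>\<^sub>i (X - b\<^sub>i)\<close> with \<open>i \<ge> 2\<close>, and finally
  \<open>(X - x\<^sub>1 x\<^sub>2) \<Prod>\<^sub>i (X - b\<^sub>i)\<close> with \<open>i \<ge> 3\<close>.
\<close>

section \<open>Lagrange interpolation\<close>

text \<open>The interpolation polynomial \<open>q\<close> and \<open>p\<close> agree at
  \<open>card I\<close> distinct points and both have smaller degree, hence coincide. The basis
  numerators \<open>L r\<close> are monic of degree \<open>card I - 1\<close>, so this coefficient
  of \<open>q\<close> is the sum.\<close>

lemma sum_lagrange_coeff:
  fixes a :: "'i \<Rightarrow> 'a::field" and p :: "'a poly"
  assumes "finite I" "inj_on a I" "degree p < card I"
  shows "(\<Sum>r\<in>I. poly p (a r) / (\<Prod>i\<in>I - {r}. a r - a i)) = coeff p (card I - 1)"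
proof -
  define D where "D r = (\<Prod>i\<in>I - {r}. a r - a i)" for r
  define L where "L r = (\<Prod>i\<in>I - {r}. [:- a i, 1:])" for r
  define q where "q = (\<Sum>r\<in>I. smult (poly p (a r) / D r) (L r))"
  have D0: "D r \<noteq> 0" if "r \<in> I" for r
    using assms that by (auto simp: D_def inj_on_def)
  have degL: "degree (L r) = card I - 1" and coeffL: "coeff (L r) (card I - 1) = 1"
    if "r \<in> I" for r
  proof -
    show *: "degree (L r) = card I - 1"
      unfolding L_def using that assms(1) by (subst degree_prod_eq_sum_degree) auto
    have "lead_coeff (L r) = 1" unfolding L_def by (simp add: lead_coeff_prod)
    then show "coeff (L r) (card I - 1) = 1" by (simp add: *)
  qed
  have "degree q \<le> card I - 1"
    unfolding q_def
    by (intro degree_sum_le) (use assms degL in \<open>auto intro: degree_smult_le[THEN order_trans]\<close>)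
  then have degq: "degree q < card I" using assms(3) by linarith
  have "poly q (a k) = poly p (a k)" if "k \<in> I" for k
  proof -
    have "poly (L r) (a k) = (if r = k then D k else 0)" if "r \<in> I" for r
      using assms(1) \<open>k \<in> I\<close> unfolding L_def D_def by (auto simp: poly_prod)
    then have "poly q (a k) = (\<Sum>r\<in>I. if r = k then poly p (a k) else 0)"
      unfolding q_def poly_sum by (intro sum.cong) (use D0 in auto)
    then show ?thesis using assms(1) that by simp
  qed
  then have "q = p"
    by (intro poly_eqI_degree[of "a ` I"]) (use assms degq in \<open>auto simp: card_image\<close>)
  have "coeff q (card I - 1) = (\<Sum>r\<in>I. poly p (a r) / D r)"
    unfolding q_def coeff_sum using coeffL by (intro sum.cong) auto
  then show ?thesis using \<open>q = p\<close> by (simp add: D_def)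
qed

lemma coeff_prod_linear:
  fixes b :: "'i \<Rightarrow> 'a::idom"
  assumes "finite I" "I \<noteq> {}"
  shows "coeff (\<Prod>i\<in>I. [:- b i, 1:]) (card I - 1) = - sum b I"
  using assms
proof (induction I rule: finite_ne_induct)
  case (insert k F)
  let ?P = "\<Prod>i\<in>F. [:- b i, 1:]"
  have "degree ?P = card F" by (subst degree_prod_eq_sum_degree) auto
  moreover have "lead_coeff ?P = 1" by (simp add: lead_coeff_prod)
  ultimately have "coeff ?P (card F) = 1" by simp
  moreover obtain m where "card F = Suc m"
    using insert by (metis card_gt_0_iff gr0_implies_Suc)
  ultimately show ?case using insert by simp
qed simp

lemma degree_monic_diff_less:
  fixes p q :: "'a::comm_ring_1 poly"
  assumes "degree p = d" "degree q = d" "lead_coeff p = 1" "lead_coeff q = 1" "0 < d"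
  shows "degree (p - q) < d"
proof -
  have "degree (p - q) \<le> d - 1"
  proof (rule degree_le, safe)
    fix i assume "d - 1 < i"
    then consider "i = d" | "d < i" by linarith
    then show "coeff (p - q) i = 0" using assms by cases (auto simp: coeff_eq_0)
  qed
  then show ?thesis using assms(5) by linarith
qed

lemma sum_lagrange_prod:
  fixes a b :: "'i \<Rightarrow> 'a::field"
  assumes "finite I" "inj_on a I"
  shows "(\<Sum>r\<in>I. (\<Prod>i\<in>I. a r - b i) / (\<Prod>i\<in>I - {r}. a r - a i)) = sum a I - sum b I"
proof (cases "I = {}")
  case False
  define p where "p c = (\<Prod>i\<in>I. [:- c i, 1:])" for c :: "'i \<Rightarrow> 'a"
  have p: "degree (p c) = card I" "lead_coeff (p c) = 1" for c
  proof -
    show "degree (p c) = card I" unfolding p_def by (subst degree_prod_eq_sum_degree) auto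
    show "lead_coeff (p c) = 1" unfolding p_def by (simp add: lead_coeff_prod)
  qed
  have "degree (p b - p a) < card I"
    using p False assms(1) by (intro degree_monic_diff_less) (auto simp: card_gt_0_iff)
  from sum_lagrange_coeff[OF assms this]
  have "(\<Sum>r\<in>I. poly (p b - p a) (a r) / (\<Prod>i\<in>I - {r}. a r - a i)) = sum a I - sum b I"
    using coeff_prod_linear[OF assms(1) False, of a] coeff_prod_linear[OF assms(1) False, of b]
    by (simp add: p_def)
  moreover have "poly (p b - p a) (a r) = (\<Prod>i\<in>I. a r - b i)" if "r \<in> I" for r
    using that assms(1) by (auto simp: p_def poly_prod intro!: prod.cong)
  ultimately show ?thesis by simp
qed simp

text \<open>The coefficient read off is the leading one, as \<open>card J\<close> is exactly
  \<open>card I - 1\<close>.\<close>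

lemma sum_lagrange_monic:
  fixes a b :: "'i \<Rightarrow> 'a::field"
  assumes "finite I" "inj_on a I" "J \<subseteq> I" "card I = Suc (card J)"
  shows "(\<Sum>r\<in>I. (\<Prod>i\<in>J. a r - b i) / (\<Prod>i\<in>I - {r}. a r - a i)) = 1"
proof -
  define p where "p = (\<Prod>i\<in>J. [:- b i, 1:])"
  have p: "degree p = card J" "lead_coeff p = 1"
  proof -
    show "degree p = card J" unfolding p_def by (subst degree_prod_eq_sum_degree) auto
    show "lead_coeff p = 1" unfolding p_def by (simp add: lead_coeff_prod)
  qed
  have "degree p < card I" using p assms by simp
  from sum_lagrange_coeff[OF assms(1,2) this]
  have "(\<Sum>r\<in>I. poly p (a r) / (\<Prod>i\<in>I - {r}. a r - a i)) = 1"
    using p assms(4) by simp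
  then show ?thesis by (simp add: p_def poly_prod)
qed

lemma prod_ratio_atLeastAtMost:
  "0 < m \<Longrightarrow> (\<Prod>k\<in>{2..m}. of_nat k / (of_nat k - 1)) = (of_nat m :: 'a::field_char_0)"
proof (induction m rule: nat_induct_non_zero)
  case (Suc m)
  then have "{2..Suc m} = insert (Suc m) {2..m}" by auto
  with Suc show ?case by simp
qed simp

section \<open>Shifted hook lengths\<close>

locale distinct_parts =
  fixes lam :: "nat list" and n :: nat
  assumes strict: "strict_partition lam n"
begin

abbreviation "hook_len \<equiv> shifted_hook_length lam"

lemma part_pos: "1 \<le> i \<Longrightarrow> i \<le> length lam \<Longrightarrow> 0 < part lam i"
  using strict unfolding strict_partition_def Defs.part_def by auto

lemma part_decreasing: "1 \<le> i \<Longrightarrow> i < k \<Longrightarrow> k \<le> length lam \<Longrightarrow> part lam k < part lam i"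
  using strict unfolding strict_partition_def Defs.part_def sorted_wrt_iff_nth_less by auto

text \<open>Row \<open>i\<close> ends in column \<open>part lam i + i - 1\<close>; the shift of one
  column per row turns the strict decrease of the parts into a weak decrease of the row
  ends.\<close>

lemma part_add_index_antimono:
  assumes "1 \<le> i" "i \<le> k" "k \<le> length lam"
  shows "part lam k + k \<le> part lam i + i"
  using assms(2,3)
proof (induction k rule: dec_induct)
  case (step k)
  then show ?case using part_decreasing[of k "Suc k"] assms(1) by auto
qed simp

text \<open>Comparison with the last row: every row reaches column
  \<open>length lam\<close>.\<close>

lemma length_less_part_add_index:
  "1 \<le> i \<Longrightarrow> i \<le> length lam \<Longrightarrow> length lam < part lam i + i"
  using part_add_index_antimono[of i "length lam"] part_pos[of "length lam"] by linarith

lemma length_pos: "0 < length lam"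
  using strict unfolding strict_partition_def by auto

lemma in_shifted_diagram:
  "(i, j) \<in> shifted_diagram lam \<longleftrightarrow> 1 \<le> i \<and> i \<le> length lam \<and> i \<le> j \<and> j < part lam i + i"
  using part_pos[of i] unfolding shifted_diagram_def by auto

text \<open>Rows starting to the right of column \<open>j\<close> are counted too, so this is the
  number of squares in the column only for \<open>length lam \<le> j\<close>.\<close>

definition column_length :: "nat \<Rightarrow> nat" where
  "column_length j = card {k \<in> {1..length lam}. j < part lam k + k}"

text \<open>Since the row ends weakly decrease, the rows counted by \<open>column_length j\<close>
  form an initial segment.\<close>

lemma less_part_add_index_iff:
  assumes "1 \<le> k" "k \<le> length lam"
  shows "j < part lam k + k \<longleftrightarrow> k \<le> column_length j"
proof -
  let ?S = "{k \<in> {1..length lam}. j < part lam k + k}"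
  have down: "{1..m} \<subseteq> ?S" if "m \<in> ?S" for m
    using that part_add_index_antimono by fastforce
  show ?thesis
  proof
    assume "j < part lam k + k"
    then have "{1..k} \<subseteq> ?S" using down assms by simp
    then show "k \<le> column_length j"
      unfolding column_length_def using card_mono[of ?S "{1..k}"] by simp
  next
    assume k: "k \<le> column_length j"
    show "j < part lam k + k"
    proof (rule ccontr)
      assume "\<not> j < part lam k + k"
      then have "m < k" if "m \<in> ?S" for m
        using subsetD[OF down[OF that], of k] assms \<open>\<not> j < part lam k + k\<close>
        by (cases "m < k") auto
      then have "?S \<subseteq> {1..<k}" by auto
      then have "column_length j \<le> k - 1"
        unfolding column_length_def using card_mono[of "{1..<k}" ?S] by simp
      then show False using k assms by linarith
    qed
  qed
qed

lemma column_length_le: "column_length j \<le> length lam"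
  unfolding column_length_def by (rule order_trans[OF card_mono[of "{1..length lam}"]]) auto

lemma column_length_corner:
  assumes "(r, s) \<in> shifted_corners lam"
  shows "column_length s = r"
proof -
  have r: "1 \<le> r" "r \<le> length lam" "r \<le> s" "s + 1 = part lam r + r"
    and nxt: "(r + 1, s) \<notin> shifted_diagram lam"
    using assms unfolding shifted_corners_def by (auto simp: in_shifted_diagram)
  have "r \<le> column_length s" using less_part_add_index_iff[of r s] r by simp
  moreover have "\<not> r + 1 \<le> column_length s"
  proof
    assume *: "r + 1 \<le> column_length s"
    then have "r + 1 \<le> length lam" using column_length_le[of s] by linarith
    then have "s < part lam (r + 1) + (r + 1)" "length lam < s + 1"
      using * less_part_add_index_iff[of "r + 1" s] length_less_part_add_index[of r] r by auto
    with nxt \<open>r + 1 \<le> length lam\<close> show False by (auto simp: in_shifted_diagram)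
  qed
  ultimately show ?thesis by linarith
qed

text \<open>Column \<open>j\<close> goes down to the diagonal square \<open>(j, j)\<close>, and the
  hook continues with all of row \<open>j + 1\<close>. The arm has \<open>part lam i + i - j\<close>
  squares and the leg \<open>j - i\<close>, so \<open>i\<close> and \<open>j\<close> cancel.\<close>

lemma shifted_hook_length_less:
  assumes "1 \<le> i" "i \<le> j" "j < length lam"
  shows "hook_len i j = int (part lam i + part lam (j + 1))"
proof -
  let ?A = "Pair i ` {j..<part lam i + i}" and ?B = "(\<lambda>k. (k, j)) ` {i<..j}"
    and ?C = "Pair (j + 1) ` {j+1..<part lam (j + 1) + (j + 1)}"
  have j: "j < part lam k + k" if "1 \<le> k" "k \<le> j" for k
    using length_less_part_add_index[of k] that assms by linarith
  have "shifted_hook lam i j = ?A \<union> ?B \<union> ?C"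
    unfolding shifted_hook_def using assms j by (auto simp: in_shifted_diagram image_iff)
  moreover have "card (?A \<union> ?B \<union> ?C) = card ?A + card ?B + card ?C"
    using assms by (simp add: card_Un_disjoint disjoint_iff image_iff)
  moreover have "card ?A + card ?B + card ?C = part lam i + part lam (j + 1)"
    using assms j[of i] by (simp add: card_image inj_on_def)
  ultimately show ?thesis
    unfolding shifted_hook_length_def using assms j[of i] by (simp add: in_shifted_diagram)
qed

text \<open>There is no row \<open>j + 1\<close> here, so the hook consists of arm and leg
  only.\<close>

lemma shifted_hook_length_ge:
  assumes "1 \<le> i" "i \<le> length lam" "length lam \<le> j" "j < part lam i + i"
  shows "hook_len i j = int (part lam i) + int (column_length j) - int j"
proof -
  let ?A = "Pair i ` {j..<part lam i + i}" and ?B = "(\<lambda>k. (k, j)) ` {i<..column_length j}"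
  have i: "i \<le> column_length j" using less_part_add_index_iff assms by simp
  have "shifted_hook lam i j = ?A \<union> ?B"
    unfolding shifted_hook_def using assms less_part_add_index_iff column_length_le[of j]
    by (auto simp: in_shifted_diagram image_iff)
  moreover have "card (?A \<union> ?B) = card ?A + card ?B"
    by (simp add: card_Un_disjoint disjoint_iff image_iff)
  moreover have "int (card ?A + card ?B) = int (part lam i) + int (column_length j) - int j"
    using assms i by (simp add: card_image inj_on_def)
  ultimately show ?thesis
    unfolding shifted_hook_length_def using assms by (simp add: in_shifted_diagram)
qed

section \<open>Rational hook lengths around a corner\<close>

abbreviation "x i \<equiv> (of_nat (part lam i) :: rat)"
abbreviation "h i j \<equiv> (of_int (hook_len i j) :: rat)"

lemma x_pos: "1 \<le> i \<Longrightarrow> i \<le> length lam \<Longrightarrow> 1 \<le> x i"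
  using part_pos[of i] by simp

lemma x_decreasing: "1 \<le> i \<Longrightarrow> i < k \<Longrightarrow> k \<le> length lam \<Longrightarrow> x k + 1 \<le> x i"
proof -
  assume "1 \<le> i" "i < k" "k \<le> length lam"
  from part_decreasing[OF this] have "part lam k + 1 \<le> part lam i" by simp
  then have "of_nat (part lam k + 1) \<le> x i" by (subst of_nat_le_iff)
  then show ?thesis by simp
qed

lemma column_length_antimono: "j \<le> j' \<Longrightarrow> column_length j' \<le> column_length j"
  unfolding column_length_def by (intro card_mono) auto

lemma cornerD:
  assumes "(r, s) \<in> shifted_corners lam"
  shows "1 \<le> r" "r \<le> length lam" "r \<le> s" "s + 1 = part lam r + r" "length lam \<le> s"
  using assms length_less_part_add_index[of r]
  unfolding shifted_corners_def by (auto simp: in_shifted_diagram)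

lemma shifted_corners_iff:
  "(r, s) \<in> shifted_corners lam \<longleftrightarrow>
     1 \<le> r \<and> r \<le> length lam \<and> s + 1 = part lam r + r \<and>
     (r < length lam \<longrightarrow> part lam r \<noteq> part lam (r + 1) + 1)"
  (is "?L \<longleftrightarrow> ?R")
proof (cases "1 \<le> r \<and> r \<le> length lam \<and> s + 1 = part lam r + r")
  case True
  then have D: "(r, s) \<in> shifted_diagram lam" "(r, s + 1) \<notin> shifted_diagram lam"
    using part_pos[of r] by (auto simp: in_shifted_diagram)
  show ?thesis
    using True D part_decreasing[of r "r + 1"] length_less_part_add_index[of r]
    unfolding shifted_corners_def by (auto simp: in_shifted_diagram)
next
  case False
  then show ?thesis using cornerD[of r s] by blast
qed

text \<open>The parts decrease strictly, and a corner excludes a drop of exactly 1 to the next row.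
  The gap keeps the denominators \<open>x r - x i - 1\<close> nonzero for the rows below.\<close>

lemma corner_part_gap:
  assumes "(r, s) \<in> shifted_corners lam" "r < i" "i \<le> length lam"
  shows "part lam i + 2 \<le> part lam r"
proof -
  have "part lam r \<noteq> part lam (r + 1) + 1" "1 \<le> r"
    using assms shifted_corners_iff[of r s] by auto
  then have "part lam (r + 1) + 2 \<le> part lam r"
    using part_decreasing[of r "r + 1"] assms by simp
  moreover have "part lam i \<le> part lam (r + 1)"
    using part_decreasing[of "r + 1" i] assms by (cases "i = r + 1") auto
  ultimately show ?thesis by linarith
qed

lemma h_row: "1 \<le> i \<Longrightarrow> i \<le> j \<Longrightarrow> j < length lam \<Longrightarrow> h i j = x i + x (j + 1)"
  by (simp add: shifted_hook_length_less)

lemma h_previous: "1 \<le> i \<Longrightarrow> i < r \<Longrightarrow> r \<le> length lam \<Longrightarrow> h i (r - 1) = x i + x r"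
  by (subst h_row) auto

lemma h_corner_column:
  assumes "(r, s) \<in> shifted_corners lam" "1 \<le> i" "i \<le> r"
  shows "h i s = x i - x r + 1"
proof -
  note c = cornerD[OF assms(1)]
  have "s < part lam i + i" using part_add_index_antimono[of i r] c assms by linarith
  then have "hook_len i s = int (part lam i) + int (column_length s) - int s"
    using c assms by (intro shifted_hook_length_ge) auto
  also have "\<dots> = int (part lam i) - int (part lam r) + 1"
    using c column_length_corner[OF assms(1)] by simp
  finally show ?thesis by simp
qed

text \<open>Provides the conventional value at squares such as \<open>(1, 0)\<close>,
  \<open>(2, 0)\<close> and \<open>(2, 1)\<close>, which the identities mention for corners in the
  first two rows.\<close>

lemma h_outside: "i = 0 \<or> j < i \<Longrightarrow> h i j = 1"
  by (auto simp: shifted_hook_length_def in_shifted_diagram)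

text \<open>The factors combine to \<open>\<Prod>k\<in>{2..part lam r}. k / (k - 1)\<close>, which telescopes: the hook lengths in
  these columns and the differences \<open>part lam r - part lam i\<close> partition \<open>{2..part lam r}\<close>.\<close>

lemma corner_row_tail:
  assumes "(r, s) \<in> shifted_corners lam"
  shows "(\<Prod>j\<in>{length lam..<s}. h r j / (h r j - 1)) *
     (\<Prod>i\<in>{r<..length lam}. (x r - x i) / (x r - x i - 1)) = x r"
proof -
  note c = cornerD[OF assms]
  define f :: "nat \<Rightarrow> rat" where "f k = of_nat k / (of_nat k - 1)" for k
  define g where "g j = part lam r + column_length j - j" for j
  let ?J = "{length lam..<s}" and ?I = "{r<..length lam}" and ?d = "\<lambda>i. part lam r - part lam i"
  have col: "r \<le> column_length j" "column_length j \<le> j" "j + 2 \<le> part lam r + column_length j"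
    if "j \<in> ?J" for j
  proof -
    show 1: "r \<le> column_length j"
      using less_part_add_index_iff[of r j] c that by simp
    show "column_length j \<le> j" using column_length_le[of j] that by simp
    show "j + 2 \<le> part lam r + column_length j" using 1 c that by simp
  qed
  have hg: "h r j = of_nat (g j)" if "j \<in> ?J" for j
    using shifted_hook_length_ge[of r j] c col[OF that] that by (simp add: g_def)
  have injg: "inj_on g ?J"
  proof (rule linorder_inj_onI)
    fix j j' assume "j < j'" "j \<in> ?J" "j' \<in> ?J"
    then show "g j \<noteq> g j'"
      using column_length_antimono[of j j'] col[of j] col[of j'] by (simp add: g_def)
  qed auto
  have gap: "part lam i + 2 \<le> part lam r" if "i \<in> ?I" for i
    using corner_part_gap[OF assms] that by simp
  have injd: "inj_on ?d ?I"
  proof (rule linorder_inj_onI)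
    fix i i' assume "i < i'" "i \<in> ?I" "i' \<in> ?I"
    then show "?d i \<noteq> ?d i'"
      using part_decreasing[of i i'] gap[of i] gap[of i'] c(1) by simp
  qed auto
  have disj: "g ` ?J \<inter> ?d ` ?I = {}"
  proof -
    \<comment> \<open>Equality would force \<open>part lam i + column_length j = j\<close>, but
      \<open>part lam i + i\<close> exceeds \<open>j\<close> exactly if
      \<open>i \<le> column_length j\<close>; either case is contradictory.\<close>
    have "g j \<noteq> ?d i" if "j \<in> ?J" "i \<in> ?I" for i j
    proof
      assume "g j = ?d i"
      then have "part lam i + column_length j = j"
        using col[OF that(1)] gap[OF that(2)] by (simp add: g_def)
      then show False
        using less_part_add_index_iff[of i j] that c(1) by (cases "i \<le> column_length j") auto
    qed
    then show ?thesis by blast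
  qed
  \<comment> \<open>Two disjoint injective images inside the interval exhaust it by counting:
    \<open>(s - length lam) + (length lam - r) = part lam r - 1\<close>.\<close>
  have "g ` ?J \<union> ?d ` ?I = {2..part lam r}"
  proof (rule card_subset_eq)
    show "g ` ?J \<union> ?d ` ?I \<subseteq> {2..part lam r}"
    proof (safe; simp only: atLeastAtMost_iff)
      fix j assume "j \<in> ?J"
      then show "2 \<le> g j \<and> g j \<le> part lam r" using col[of j] unfolding g_def by linarith
    next
      fix i assume "i \<in> ?I"
      then show "2 \<le> ?d i \<and> ?d i \<le> part lam r" using gap[of i] by simp
    qed
    have "card (g ` ?J \<union> ?d ` ?I) = (s - length lam) + (length lam - r)"
      using disj injg injd by (simp add: card_Un_disjoint card_image)
    then show "card (g ` ?J \<union> ?d ` ?I) = card {2..part lam r}"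
      using c by simp
  qed simp
  then have "x r = prod f (g ` ?J \<union> ?d ` ?I)"
    unfolding f_def using prod_ratio_atLeastAtMost[where 'a = rat, of "part lam r"] part_pos[of r] c by simp
  also have "\<dots> = prod f (g ` ?J) * prod f (?d ` ?I)"
    using disj by (simp add: prod.union_disjoint)
  also have "prod f (g ` ?J) = (\<Prod>j\<in>?J. h r j / (h r j - 1))"
    using injg hg by (simp add: prod.reindex f_def)
  also have "prod f (?d ` ?I) = (\<Prod>i\<in>?I. (x r - x i) / (x r - x i - 1))"
    unfolding prod.reindex[OF injd] o_def
  proof (rule prod.cong)
    fix i assume "i \<in> ?I"
    then have "of_nat (?d i) = x r - x i" using gap[of i] by (simp add: of_nat_diff)
    then show "f (?d i) = (x r - x i) / (x r - x i - 1)" by (simp add: f_def)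
  qed simp
  finally show ?thesis by simp
qed

section \<open>Collapse of the hook ratios at a corner\<close>

abbreviation "a i \<equiv> x i * (x i - 1)"
abbreviation "b i \<equiv> x i * (x i + 1)"

lemma inj_on_a: "inj_on a {1..length lam}"
proof (rule linorder_inj_onI)
  fix i k assume "i < k" "i \<in> {1..length lam}" "k \<in> {1..length lam}"
  then have "x k < x i" "1 \<le> x k" using x_decreasing[of i k] x_pos[of k] by auto
  then have "x k * (x k - 1) < x i * (x i - 1)"
    by (intro mult_strict_mono') auto
  then show "a i \<noteq> a k" by simp
qed auto

text \<open>The ratio of the corner term of row \<open>r\<close> in the first identity to the
  product on the left. It depends on \<open>r\<close> alone and makes sense for rows without a
  corner.\<close>

definition weight :: "nat \<Rightarrow> rat" where
  "weight r = x r * (\<Prod>i\<in>{1..length lam} - {r}. (a r - b i) / (a r - a i))"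

text \<open>For a row \<open>i\<close> above a corner \<open>(r, s)\<close> the factors in the first
  equation are \<open>h i s\<close> and \<open>h i (r - 1)\<close>; in the second they are these
  hook lengths minus 1.\<close>

lemma a_minus_b: "a r - b i = - ((x i - x r + 1) * (x i + x r))"
  and a_minus_a: "a r - a i = - ((x i - x r) * (x i + x r - 1))"
  by (simp_all add: algebra_simps)

lemma h_ge_2:
  assumes "(r, s) \<in> shifted_corners lam" "r \<le> j" "j < s"
  shows "2 \<le> h r j"
proof (cases "j < length lam")
  case True
  then show ?thesis
    using h_row[of r j] x_pos[of r] x_pos[of "j + 1"] cornerD[OF assms(1)] assms by simp
next
  case False
  then have "r \<le> column_length j"
    using less_part_add_index_iff[of r j] cornerD[OF assms(1)] assms by simp
  then have "2 \<le> hook_len r j"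
    using shifted_hook_length_ge[of r j] cornerD[OF assms(1)] assms False by simp
  then show ?thesis by simp
qed

text \<open>The two columns account for the factors of \<open>weight r\<close> with
  \<open>i < r\<close>. In row \<open>r\<close>, the columns before \<open>length lam\<close> give
  the factors in \<open>x r + x i\<close> with \<open>i > r\<close>, the remaining ones those in
  \<open>x r - x i\<close> and the leading \<open>x r\<close>.\<close>

lemma corner_ratio:
  assumes "(r, s) \<in> shifted_corners lam"
  shows "(\<Prod>i\<in>{1..<r}. h i s / (h i s - 1)) * (\<Prod>j\<in>{r..<s}. h r j / (h r j - 1)) *
     (\<Prod>i\<in>{1..<r}. h i (r - 1) / (h i (r - 1) - 1)) = weight r"
proof -
  note c = cornerD[OF assms]
  let ?w = "\<lambda>i. (a r - b i) / (a r - a i)" and ?I = "{r<..length lam}"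
  have "(\<Prod>i\<in>{1..<r}. h i s / (h i s - 1)) * (\<Prod>i\<in>{1..<r}. h i (r - 1) / (h i (r - 1) - 1)) =
      (\<Prod>i\<in>{1..<r}. ?w i)"
    unfolding prod.distrib[symmetric] a_minus_a a_minus_b
  proof (rule prod.cong)
    fix i assume "i \<in> {1..<r}"
    then have "h i s = x i - x r + 1" "h i (r - 1) = x i + x r"
      using c h_corner_column[OF assms, of i] h_previous[of i r] by auto
    then show "h i s / (h i s - 1) * (h i (r - 1) / (h i (r - 1) - 1)) =
        - ((x i - x r + 1) * (x i + x r)) / - ((x i - x r) * (x i + x r - 1))"
      by (simp only:) simp
  qed simp
  moreover have "(\<Prod>j\<in>{r..<s}. h r j / (h r j - 1)) = x r * (\<Prod>i\<in>?I. ?w i)"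
  proof -
    have "(\<Prod>j\<in>{r..<s}. h r j / (h r j - 1)) =
        (\<Prod>j\<in>{r..<length lam}. h r j / (h r j - 1)) * (\<Prod>j\<in>{length lam..<s}. h r j / (h r j - 1))"
      using c by (simp add: prod.atLeastLessThan_concat)
    also have "(\<Prod>j\<in>{r..<length lam}. h r j / (h r j - 1)) =
        (\<Prod>i\<in>?I. (x r + x i) / (x r + x i - 1))"
      by (rule prod.reindex_bij_witness[of _ "\<lambda>i. i - 1" "\<lambda>j. j + 1"])
        (use c in \<open>auto simp: h_row\<close>)
    also have "(\<Prod>j\<in>{length lam..<s}. h r j / (h r j - 1)) =
        x r * (\<Prod>i\<in>?I. (x r - x i - 1) / (x r - x i))"
    proof -
      have gap: "x i + 2 \<le> x r" if "i \<in> ?I" for i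
      proof -
        have "of_nat (part lam i + 2) \<le> x r"
          using corner_part_gap[OF assms, of i] that by (subst of_nat_le_iff) simp
        then show ?thesis by simp
      qed
      have "(\<Prod>i\<in>?I. (x r - x i) / (x r - x i - 1)) * (\<Prod>i\<in>?I. (x r - x i - 1) / (x r - x i)) = 1"
        unfolding prod.distrib[symmetric] by (rule prod.neutral) (use gap in force)
      \<comment> \<open>Solves \<open>corner_row_tail\<close> for the hook product by multiplying
        with the inverse of its second factor.\<close>
      moreover have "p = z * v" if "p * u = z" "u * v = 1" for p u v z :: rat
        using that by (metis mult.assoc mult.right_neutral)
      ultimately show ?thesis using corner_row_tail[OF assms] by blast
    qed
    also have "(\<Prod>i\<in>?I. (x r + x i) / (x r + x i - 1)) *
        (x r * (\<Prod>i\<in>?I. (x r - x i - 1) / (x r - x i))) =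
        x r * (\<Prod>i\<in>?I. (x r + x i) / (x r + x i - 1) * ((x r - x i - 1) / (x r - x i)))"
      by (simp only: prod.distrib mult.left_commute)
    also have "(\<Prod>i\<in>?I. (x r + x i) / (x r + x i - 1) * ((x r - x i - 1) / (x r - x i))) =
        (\<Prod>i\<in>?I. ?w i)"
    proof (rule prod.cong)
      fix i
      have "a r - b i = (x r + x i) * (x r - x i - 1)" "a r - a i = (x r + x i - 1) * (x r - x i)"
        by (simp_all add: algebra_simps)
      then show "(x r + x i) / (x r + x i - 1) * ((x r - x i - 1) / (x r - x i)) = ?w i"
        by simp
    qed simp
    finally show ?thesis .
  qed
  moreover have "{1..length lam} - {r} = {1..<r} \<union> ?I" "{1..<r} \<inter> ?I = {}"
    using c by auto
  ultimately show ?thesis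
    unfolding weight_def by (simp add: prod.union_disjoint mult_ac)
qed

section \<open>Factoring the hook product at a corner\<close>

definition hook_prod :: int where
  "hook_prod = (\<Prod>(i, j)\<in>shifted_diagram lam - shifted_corners lam. (hook_len i j - 1))"

definition remaining_prod :: "nat \<Rightarrow> nat \<Rightarrow> int" where
  "remaining_prod r s =
     (\<Prod>(i, j)\<in>{(i, j) \<in> shifted_diagram lam - shifted_corners lam. i \<noteq> r \<and> j \<noteq> r - 1 \<and> j \<noteq> s}.
        (hook_len i j - 1))"

lemma finite_shifted_diagram: "finite (shifted_diagram lam)"
proof (rule finite_subset)
  show "shifted_diagram lam \<subseteq> (SIGMA i:{1..length lam}. {..<part lam i + i})"
    by (auto simp: in_shifted_diagram)
qed auto

text \<open>The non-corner squares left out of \<open>remaining_prod r s\<close> are those above the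
  corner, those to its left in row \<open>r\<close>, and all of column \<open>r - 1\<close>, which
  is empty for \<open>r = 1\<close>. Nothing lies below the corner.\<close>

lemma hook_prod_corner:
  assumes "(r, s) \<in> shifted_corners lam"
  shows "hook_prod = remaining_prod r s * (\<Prod>i\<in>{1..<r}. hook_len i s - 1) *
     (\<Prod>j\<in>{r..<s}. hook_len r j - 1) * (\<Prod>i\<in>{1..<r}. hook_len i (r - 1) - 1)"
proof -
  note c = cornerD[OF assms]
  let ?D = "shifted_diagram lam - shifted_corners lam"
  let ?E = "{(i, j) \<in> ?D. i \<noteq> r \<and> j \<noteq> r - 1 \<and> j \<noteq> s}"
  let ?A = "(\<lambda>i. (i, s)) ` {1..<r}" and ?B = "Pair r ` {r..<s}"
    and ?C = "(\<lambda>i. (i, r - 1)) ` {1..<r}"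
  have above: "s < part lam i + i" if "1 \<le> i" "i \<le> r" for i
    using part_add_index_antimono[of i r] c that by linarith
  \<comment> \<open>No square of \<open>?A\<close>, \<open>?B\<close>, \<open>?C\<close> is a
    corner: the diagram contains \<open>(i + 1, s)\<close>, \<open>(r, j + 1)\<close> and
    \<open>(i, r)\<close>, respectively.\<close>
  have A: "?A \<subseteq> ?D"
  proof (rule image_subsetI)
    fix i assume "i \<in> {1..<r}"
    then show "(i, s) \<in> ?D"
      using c above[of i] above[of "i + 1"] unfolding shifted_corners_def
      by (auto simp: in_shifted_diagram)
  qed
  have B: "?B \<subseteq> ?D"
    using c unfolding shifted_corners_def by (auto simp: in_shifted_diagram)
  have C: "?C \<subseteq> ?D"
  proof (rule image_subsetI)
    fix i assume "i \<in> {1..<r}"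
    then show "(i, r - 1) \<in> ?D"
      using c above[of i] unfolding shifted_corners_def by (auto simp: in_shifted_diagram)
  qed
  have D: "?D \<subseteq> ?E \<union> ?A \<union> ?B \<union> ?C"
  proof
    fix p assume "p \<in> ?D"
    then obtain i j where p: "p = (i, j)" "(i, j) \<in> shifted_diagram lam"
      "(i, j) \<notin> shifted_corners lam" by (cases p) auto
    consider "i = r" | "i \<noteq> r" "j = s" | "i \<noteq> r" "j = r - 1" | "i \<noteq> r" "j \<noteq> s" "j \<noteq> r - 1" by blast
    then show "p \<in> ?E \<union> ?A \<union> ?B \<union> ?C"
    proof cases
      case 1
      then have "j \<noteq> s" using p assms by blast
      then have "j \<in> {r..<s}" using 1 p c by (auto simp: in_shifted_diagram)
      then show ?thesis using 1 p by auto
    next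
      case 2
      then have "i \<le> r"
        using p less_part_add_index_iff[of i s] column_length_corner[OF assms]
        by (simp add: in_shifted_diagram)
      then have "i \<in> {1..<r}" using 2 p by (auto simp: in_shifted_diagram)
      then show ?thesis using 2 p by auto
    next
      case 3
      then have "i \<in> {1..<r}" using p by (auto simp: in_shifted_diagram)
      then show ?thesis using 3 p by auto
    next
      case 4
      then show ?thesis using p by auto
    qed
  qed
  have split: "?D = ?E \<union> ?A \<union> ?B \<union> ?C"
    by (rule subset_antisym[OF D], intro Un_least A B C) auto
  have fin: "finite ?E" by (rule finite_subset[OF _ finite_shifted_diagram]) auto
  have inter: "?E \<inter> ?A = {}" "(?E \<union> ?A) \<inter> ?B = {}" "(?E \<union> ?A \<union> ?B) \<inter> ?C = {}"
    using c by auto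
  have parts: "prod f ?D = prod f ?E * prod f ?A * prod f ?B * prod f ?C" for f :: "nat \<times> nat \<Rightarrow> int"
  proof -
    have "prod f ?D = prod f (?E \<union> ?A \<union> ?B \<union> ?C)" by (rule arg_cong[OF split])
    also have "\<dots> = prod f (?E \<union> ?A \<union> ?B) * prod f ?C"
      by (rule prod.union_disjoint[OF _ _ inter(3)]; intro finite_UnI fin finite_imageI) simp_all
    also have "prod f (?E \<union> ?A \<union> ?B) = prod f (?E \<union> ?A) * prod f ?B"
      by (rule prod.union_disjoint[OF _ _ inter(2)]; intro finite_UnI fin finite_imageI) simp_all
    also have "prod f (?E \<union> ?A) = prod f ?E * prod f ?A"
      by (rule prod.union_disjoint[OF _ _ inter(1)]; intro fin finite_imageI) simp_all
    finally show ?thesis .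
  qed
  have "prod f ?A = (\<Prod>i\<in>{1..<r}. f (i, s))" "prod f ?B = (\<Prod>j\<in>{r..<s}. f (r, j))"
    "prod f ?C = (\<Prod>i\<in>{1..<r}. f (i, r - 1))" for f :: "nat \<times> nat \<Rightarrow> int"
    by (simp_all add: prod.reindex inj_on_def)
  then show ?thesis
    unfolding hook_prod_def remaining_prod_def parts by (simp only: prod.case)
qed

text \<open>Each factor \<open>h - 1\<close> outside \<open>remaining_prod r s\<close> meets its
  ratio \<open>h / (h - 1)\<close> from \<open>corner_ratio\<close>, leaving \<open>h\<close>. The
  product form avoids a division by \<open>hook_prod\<close>.\<close>

lemma corner_term:
  assumes "(r, s) \<in> shifted_corners lam"
  shows "of_int (remaining_prod r s * (\<Prod>i\<in>{1..<r}. hook_len i s) *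
     (\<Prod>j\<in>{r..<s}. hook_len r j) * (\<Prod>i\<in>{1..<r}. hook_len i (r - 1))) =
     of_int hook_prod * weight r"
proof -
  note c = cornerD[OF assms]
  have cancel: "(\<Prod>k\<in>K. u k - 1) * (\<Prod>k\<in>K. u k / (u k - 1)) = prod u K"
    if "\<And>k. k \<in> K \<Longrightarrow> u k \<noteq> 1" for K and u :: "nat \<Rightarrow> rat"
    unfolding prod.distrib[symmetric] by (rule prod.cong) (use that in auto)
  have "of_int hook_prod * weight r = of_int (remaining_prod r s) *
      ((\<Prod>i\<in>{1..<r}. h i s - 1) * (\<Prod>i\<in>{1..<r}. h i s / (h i s - 1))) *
      ((\<Prod>j\<in>{r..<s}. h r j - 1) * (\<Prod>j\<in>{r..<s}. h r j / (h r j - 1))) *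
      ((\<Prod>i\<in>{1..<r}. h i (r - 1) - 1) * (\<Prod>i\<in>{1..<r}. h i (r - 1) / (h i (r - 1) - 1)))"
    unfolding hook_prod_corner[OF assms] corner_ratio[OF assms, symmetric]
    by (simp only: of_int_mult of_int_prod of_int_diff of_int_1 mult_ac)
  also have "(\<Prod>i\<in>{1..<r}. h i s - 1) * (\<Prod>i\<in>{1..<r}. h i s / (h i s - 1)) = (\<Prod>i\<in>{1..<r}. h i s)"
    by (rule cancel) (use x_decreasing[of _ r] h_corner_column[OF assms] c in force)
  also have "(\<Prod>j\<in>{r..<s}. h r j - 1) * (\<Prod>j\<in>{r..<s}. h r j / (h r j - 1)) = (\<Prod>j\<in>{r..<s}. h r j)"
    by (rule cancel) (use h_ge_2[OF assms] in force)
  also have "(\<Prod>i\<in>{1..<r}. h i (r - 1) - 1) * (\<Prod>i\<in>{1..<r}. h i (r - 1) / (h i (r - 1) - 1)) =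
      (\<Prod>i\<in>{1..<r}. h i (r - 1))"
  proof (rule cancel)
    fix k assume "k \<in> {1..<r}"
    then show "h k (r - 1) \<noteq> 1" using h_previous[of k r] x_pos[of k] x_pos[of r] c by simp
  qed
  finally show ?thesis by (simp add: mult_ac)
qed

section \<open>Passage from corners to rows\<close>

lemma sum_corners:
  fixes f :: "nat \<Rightarrow> nat \<Rightarrow> int" and g :: "nat \<Rightarrow> rat"
  assumes corner: "\<And>r s. (r, s) \<in> shifted_corners lam \<Longrightarrow> of_int (f r s) = of_int hook_prod * g r"
    and noncorner: "\<And>r. \<lbrakk>1 \<le> r; r < length lam; x r = x (r + 1) + 1\<rbrakk> \<Longrightarrow> g r = 0"
  shows "of_int (\<Sum>(r, s)\<in>shifted_corners lam. f r s) = of_int hook_prod * (\<Sum>r\<in>{1..length lam}. g r)"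
proof -
  \<comment> \<open>\<open>?K\<close> consists of the rows that end in a corner, one corner each;
    the other rows contribute 0 by \<open>noncorner\<close>, so the sum extends to all rows.\<close>
  let ?K = "{r \<in> {1..length lam}. r < length lam \<longrightarrow> part lam r \<noteq> part lam (r + 1) + 1}"
  have "of_int (\<Sum>(r, s)\<in>shifted_corners lam. f r s) =
      (\<Sum>(r, s)\<in>shifted_corners lam. of_int hook_prod * g r)"
    by (auto simp: case_prod_beta corner intro!: sum.cong)
  also have "\<dots> = (\<Sum>r\<in>?K. of_int hook_prod * g r)"
    by (rule sum.reindex_bij_witness[of _ "\<lambda>r. (r, part lam r + r - 1)" fst])
      (auto simp: shifted_corners_iff)
  also have "\<dots> = (\<Sum>r\<in>{1..length lam}. of_int hook_prod * g r)"
  proof (rule sum.mono_neutral_left)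
    show "\<forall>r\<in>{1..length lam} - ?K. of_int hook_prod * g r = 0"
    proof
      fix r assume "r \<in> {1..length lam} - ?K"
      then have "1 \<le> r" "r < length lam" "part lam r = part lam (r + 1) + 1" by auto
      then show "of_int hook_prod * g r = 0" using noncorner[of r] by simp
    qed
  qed auto
  finally show ?thesis by (simp add: sum_distrib_left)
qed

definition lagrange_denom :: "nat \<Rightarrow> rat" where
  "lagrange_denom r = (\<Prod>i\<in>{1..length lam} - {r}. a r - a i)"

text \<open>The leading \<open>x r\<close> of \<open>weight r\<close> is
  \<open>- (a r - b r) / 2\<close>, so it supplies the missing factor \<open>i = r\<close> of the
  numerator.\<close>

lemma weight_eq:
  assumes "1 \<le> r" "r \<le> length lam"
  shows "weight r = - (\<Prod>i\<in>{1..length lam}. a r - b i) / (2 * lagrange_denom r)"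
proof -
  have "(\<Prod>i\<in>{1..length lam}. a r - b i) = (a r - b r) * (\<Prod>i\<in>{1..length lam} - {r}. a r - b i)"
    using assms by (subst prod.remove[of _ r]) auto
  moreover have "a r - b r = - 2 * x r" by (simp add: algebra_simps)
  ultimately show ?thesis
    unfolding weight_def lagrange_denom_def by (simp add: prod_dividef)
qed

lemma noncorner_factor: "x r = x (r + 1) + 1 \<Longrightarrow> a r - b (r + 1) = 0"
  by (simp add: algebra_simps)

text \<open>The factor \<open>i = r + 1\<close> vanishes, and \<open>m \<le> r + 1\<close> keeps it
  in range. The three identities use \<open>m\<close> equal to 1, 2 and 3.\<close>

lemma noncorner_prod:
  assumes "r < length lam" "x r = x (r + 1) + 1" "m \<le> r + 1"
  shows "(\<Prod>i\<in>{m..length lam}. a r - b i) = 0"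
  using assms noncorner_factor[OF assms(2)] by (intro prod_zero) (auto intro!: bexI[of _ "r + 1"])

section \<open>Summation over the corners\<close>

lemma prod_from_1: "2 \<le> m \<Longrightarrow> prod f {1..<m} = f 1 * prod f {2..<m}"
  for m :: nat and f :: "nat \<Rightarrow> 'b::comm_monoid_mult"
proof -
  assume "2 \<le> m"
  then have "{1..<m} = insert 1 {2..<m}" by auto
  then show ?thesis by simp
qed

lemma first_identity:
  "int n * hook_prod = (\<Sum>(r, s)\<in>shifted_corners lam.
     remaining_prod r s * (\<Prod>i\<in>{1..<r}. hook_len i s) * (\<Prod>j\<in>{r..<s}. hook_len r j) *
     (\<Prod>i\<in>{1..<r}. hook_len i (r - 1)))"
  (is "_ = (\<Sum>(r, s)\<in>_. ?f r s)")
proof -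
  let ?I = "{1..length lam}"
  have n: "n = (\<Sum>i\<in>?I. part lam i)"
  proof -
    have "n = (\<Sum>i<length lam. lam ! i)"
      using strict unfolding strict_partition_def by (simp add: sum_list_sum_nth atLeast0LessThan)
    also have "\<dots> = (\<Sum>i\<in>?I. part lam i)"
      by (rule sum.reindex_bij_witness[of _ "\<lambda>i. i - 1" "\<lambda>i. i + 1"]) (auto simp: Defs.part_def)
    finally show ?thesis .
  qed
  have "(\<Sum>r\<in>?I. weight r) =
      (\<Sum>r\<in>?I. - (1 / 2) * ((\<Prod>i\<in>?I. a r - b i) / lagrange_denom r))"
    by (rule sum.cong) (auto simp: weight_eq)
  also have "\<dots> = - (1 / 2) * (sum a ?I - sum b ?I)"
    unfolding sum_distrib_left[symmetric] lagrange_denom_def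
    by (subst sum_lagrange_prod[OF _ inj_on_a]) auto
  \<comment> \<open>Termwise \<open>b i - a i = 2 * x i\<close>, and the parts sum to
    \<open>n\<close>.\<close>
  also have "\<dots> = of_nat n"
    unfolding n sum_subtractf[symmetric] sum_distrib_left of_nat_sum
    by (rule sum.cong) (simp_all add: algebra_simps)
  finally have total: "(\<Sum>r\<in>?I. weight r) = of_nat n" .
  have "weight r = 0" if "1 \<le> r" "r < length lam" "x r = x (r + 1) + 1" for r
    using noncorner_prod[of r 1] that by (simp add: weight_eq)
  then have "of_int (\<Sum>(r, s)\<in>shifted_corners lam. ?f r s) = of_int hook_prod * (of_nat n :: rat)"
    using sum_corners[of ?f weight, OF corner_term] total by simp
  then have "of_int (int n * hook_prod) = (of_int (\<Sum>(r, s)\<in>shifted_corners lam. ?f r s) :: rat)"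
    by simp
  then show ?thesis by (simp only: of_int_eq_iff)
qed

lemma second_identity:
  "int (part lam 1) * hook_prod = (\<Sum>(r, s)\<in>shifted_corners lam.
     (hook_len 1 (r - 1) + hook_len 1 s - 1) *
     remaining_prod r s * (\<Prod>i\<in>{2..<r}. hook_len i s) * (\<Prod>j\<in>{r..<s}. hook_len r j) *
     (\<Prod>i\<in>{2..<r}. hook_len i (r - 1)))"
  (is "_ = (\<Sum>(r, s)\<in>_. ?f r s)")
proof -
  let ?I = "{1..length lam}" and ?J = "{2..length lam}"
  define g where "g r = x 1 * ((\<Prod>i\<in>?J. a r - b i) / lagrange_denom r)" for r
  have IJ: "?I = insert 1 ?J" using length_pos by (auto simp: Suc_le_eq)
  \<comment> \<open>At a corner with \<open>r > 1\<close> the two brackets are \<open>h 1 s\<close>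
    and \<open>h 1 (r - 1)\<close>, whose product the second identity replaces by
    \<open>h 1 (r - 1) + h 1 s - 1 = 2 * x 1\<close>. This removes the factor \<open>i = 1\<close>
    from the numerator.\<close>
  have weight: "weight r * (2 * x 1) = g r * ((x 1 - x r + 1) * (x 1 + x r))"
    if "1 \<le> r" "r \<le> length lam" for r
  proof -
    have "(\<Prod>i\<in>?I. a r - b i) = (a r - b 1) * (\<Prod>i\<in>?J. a r - b i)"
      unfolding IJ by simp
    then have "(\<Prod>i\<in>?I. a r - b i) = - ((x 1 - x r + 1) * (x 1 + x r)) * (\<Prod>i\<in>?J. a r - b i)"
      by (simp only: a_minus_b[of r 1])
    moreover have "- P / (2 * d) * (2 * y) = y * (Q / d) * A" if "P = - A * Q" for A P Q d y :: rat
      by (simp add: that)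
    ultimately show ?thesis
      unfolding weight_eq[OF that] g_def by blast
  qed
  have "of_int (?f r s) = of_int hook_prod * g r" if rs: "(r, s) \<in> shifted_corners lam" for r s
  proof (cases "r = 1")
    case True
    then have "weight 1 * (2 * x 1) = g 1 * ((x 1 - x 1 + 1) * (x 1 + x 1))" and "1 \<le> x 1"
      using cornerD[OF rs] by (intro weight x_pos; simp)+
    moreover have "w = v" if "w * (2 * y) = v * ((y - y + 1) * (y + y))" "1 \<le> y" for v w y :: rat
      using that by simp
    ultimately have "weight 1 = g 1" by blast
    \<comment> \<open>Hence the linear factor \<open>h 1 0 + h 1 s - 1\<close> is 1.\<close>
    moreover have "h 1 0 = 1" "h 1 s = 1"
      using True h_outside[of 1 0] h_corner_column[OF rs, of 1] by simp_all
    ultimately show ?thesis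
      using corner_term[OF rs] True by simp
  next
    case False
    note c = cornerD[OF rs]
    let ?u = "h 1 (r - 1)" and ?v = "h 1 s"
    have u: "?u = x 1 + x r" and v: "?v = x 1 - x r + 1"
      using h_previous[of 1 r] h_corner_column[OF rs, of 1] c False by auto
    have pos: "?u * ?v \<noteq> 0"
      using x_decreasing[of 1 r] x_pos[of r] c False unfolding u v by auto
    have split: "prod f {1..<r} = f 1 * prod f {2..<r}" for f :: "nat \<Rightarrow> int"
      by (rule prod_from_1) (use c False in simp)
    have "of_int (?f r s) * (?u * ?v) = (?u + ?v - 1) * of_int (remaining_prod r s *
       (\<Prod>i\<in>{1..<r}. hook_len i s) * (\<Prod>j\<in>{r..<s}. hook_len r j) *
       (\<Prod>i\<in>{1..<r}. hook_len i (r - 1)))"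
      unfolding split[of "\<lambda>i. hook_len i s"] split[of "\<lambda>i. hook_len i (r - 1)"]
      by (simp only: of_int_mult of_int_add of_int_diff of_int_1 mult_ac)
    also have "\<dots> = of_int hook_prod * (weight r * (2 * x 1))"
      unfolding corner_term[OF rs] u v by simp
    also have "\<dots> = (of_int hook_prod * g r) * (?u * ?v)"
      unfolding weight[OF c(1,2)] u v by (simp only: mult_ac)
    finally show ?thesis using pos by (simp only: mult_cancel_right simp_thms)
  qed
  moreover have "g r = 0" if "1 \<le> r" "r < length lam" "x r = x (r + 1) + 1" for r
    using noncorner_prod[of r 2] that by (simp add: g_def)
  moreover have "(\<Sum>r\<in>?I. g r) = x 1"
    unfolding g_def sum_distrib_left[symmetric] lagrange_denom_def
    using length_pos by (subst sum_lagrange_monic[OF _ inj_on_a]) auto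
  ultimately have "of_int (\<Sum>(r, s)\<in>shifted_corners lam. ?f r s) = of_int hook_prod * x 1"
    using sum_corners[of ?f g] by simp
  then have "of_int (int (part lam 1) * hook_prod) =
      (of_int (\<Sum>(r, s)\<in>shifted_corners lam. ?f r s) :: rat)"
    by simp
  then show ?thesis by (simp only: of_int_eq_iff)
qed

lemma third_identity:
  "hook_prod = (\<Sum>(r, s)\<in>shifted_corners lam.
     (hook_len 1 s * hook_len 2 (r - 1) + (hook_len 1 (r - 1) - 1) * (hook_len 2 s - 1)) *
     remaining_prod r s * (\<Prod>i\<in>{3..<r}. hook_len i s) * (\<Prod>j\<in>{max r 2..<s}. hook_len r j) *
     (\<Prod>i\<in>{3..<r}. hook_len i (r - 1)))"
  (is "_ = (\<Sum>(r, s)\<in>_. ?f r s)")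
proof -
  let ?I = "{1..length lam}" and ?K = "{3..length lam}"
  \<comment> \<open>A single row has no second part, so \<open>g\<close> is then set to 1, the
    required total.\<close>
  define g where "g r = (if length lam = 1 then 1 else
      (a r - x 1 * x 2) * (\<Prod>i\<in>?K. a r - b i) / lagrange_denom r)" for r
  \<comment> \<open>At a corner with \<open>r \<ge> 3\<close> the four brackets are the hook lengths
    of rows 1 and 2 in columns \<open>s\<close> and \<open>r - 1\<close>; the third identity
    replaces their product by \<open>2 * (x 1 * x 2 - a r)\<close>.\<close>
  have weight: "weight r * (2 * (x 1 * x 2 - a r)) =
      g r * ((x 1 - x r + 1) * (x 1 + x r) * ((x 2 - x r + 1) * (x 2 + x r)))"
    if "1 \<le> r" "r \<le> length lam" "2 \<le> length lam" for r
  proof -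
    have "?I = insert 1 (insert 2 ?K)" using that by auto
    then have "(\<Prod>i\<in>?I. a r - b i) = (a r - b 1) * ((a r - b 2) * (\<Prod>i\<in>?K. a r - b i))"
      by simp
    then have "(\<Prod>i\<in>?I. a r - b i) = - ((x 1 - x r + 1) * (x 1 + x r)) *
        (- ((x 2 - x r + 1) * (x 2 + x r)) * (\<Prod>i\<in>?K. a r - b i))"
      by (simp only: a_minus_b[of r 1] a_minus_b[of r 2])
    moreover have "- P / (2 * d) * (2 * (t - u)) = (u - t) * Q / d * (A * B)"
      if "P = - A * (- B * Q)" for A B P Q d t u :: rat
      by (cases "d = 0") (simp_all add: that field_simps)
    moreover have g: "g r = (a r - x 1 * x 2) * (\<Prod>i\<in>?K. a r - b i) / lagrange_denom r"
      using that by (simp add: g_def)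
    ultimately show ?thesis
      unfolding weight_eq[OF that(1,2)] g by blast
  qed
  have "of_int (?f r s) = of_int hook_prod * g r" if rs: "(r, s) \<in> shifted_corners lam" for r s
  proof -
    note c = cornerD[OF rs]
    consider "length lam = 1" | "2 \<le> length lam" "r = 1" | "r = 2" | "3 \<le> r"
      using c by linarith
    then show ?thesis
    proof cases
      case 1
      then have r: "r = 1" using c by simp
      have "1 \<le> column_length 1"
        using less_part_add_index_iff[of 1 1] part_pos[of 1] length_pos by simp
      then have "column_length 1 = 1" using column_length_le[of 1] 1 by simp
      then have h11: "h 1 1 = x 1"
        using shifted_hook_length_ge[of 1 1] part_pos[of 1] 1 by simp
      have "weight 1 = x 1" using 1 by (simp add: weight_def)
      then have eq: "of_int (remaining_prod 1 s) * (\<Prod>j\<in>{1..<s}. h 1 j) = of_int hook_prod * x 1"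
        using corner_term[OF rs] r by simp
      \<comment> \<open>The prefactor is 1 by the convention at \<open>(1, 0)\<close> and
        \<open>(2, 0)\<close>. The row product now starts at 2 and omits \<open>h 1 1 = x 1\<close>,
        which is all of \<open>weight 1\<close>.\<close>
      have "of_int (?f r s) = of_int (remaining_prod 1 s) * (\<Prod>j\<in>{2..<s}. h 1 j)"
        using r h_outside[of 1 0] h_outside[of 2 0] h_corner_column[OF rs, of 1] by (simp add: numeral_2_eq_2)
      also have "\<dots> = of_int hook_prod"
      proof (cases "2 \<le> s")
        case True
        then show ?thesis
          using eq[unfolded prod_from_1[OF True] h11] x_pos[of 1] length_pos
          by (simp add: Suc_le_eq)
      next
        case False
        then have "s = 1" "x 1 = 1" using c r by auto
        then show ?thesis using eq by simp
      qed
      finally show ?thesis using 1 by (simp add: g_def)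
    next
      case 2
      \<comment> \<open>The gap allows cancelling \<open>x 2 - x 1 + 1\<close>, a factor of
        \<open>x 1 * x 2 - a 1\<close>. The remaining \<open>x 1 + x 2\<close> is
        \<open>h 1 1\<close>, which the row product starting at 2 omits.\<close>
      have gap: "part lam 2 + 2 \<le> part lam 1" using corner_part_gap[OF rs, of 2] 2 by simp
      then have "of_nat (part lam 2 + 2) \<le> x 1" by (subst of_nat_le_iff)
      then have nz: "x 2 - x 1 + 1 \<noteq> 0" by simp
      have x: "1 \<le> x 1" "1 \<le> x 2" using x_pos[of 1] x_pos[of 2] 2 by auto
      have "2 * x 1 * (x 2 - x 1 + 1) * weight 1 = 2 * x 1 * (x 2 - x 1 + 1) * (g 1 * (x 1 + x 2))"
        using weight[of 1] 2 by (simp add: algebra_simps)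
      then have "weight 1 = g 1 * (x 1 + x 2)" using nz x by simp
      moreover have "h 1 1 = x 1 + x 2" using h_row[of 1 1] 2 by (simp add: numeral_2_eq_2)
      moreover have "2 \<le> s" using gap c 2 by simp
      moreover have "of_int (remaining_prod 1 s) * (\<Prod>j\<in>{1..<s}. h 1 j) = of_int hook_prod * weight 1"
        using corner_term[OF rs] 2 by simp
      ultimately have "of_int (remaining_prod 1 s) * (\<Prod>j\<in>{2..<s}. h 1 j) * (x 1 + x 2) =
          of_int hook_prod * g 1 * (x 1 + x 2)"
        by (simp only: prod_from_1 mult_ac)
      then have "of_int (remaining_prod 1 s) * (\<Prod>j\<in>{2..<s}. h 1 j) = of_int hook_prod * g 1"
        using x by simp
      then show ?thesis
        using 2 h_outside[of 1 0] h_outside[of 2 0] h_corner_column[OF rs, of 1] by (simp add: numeral_2_eq_2)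
    next
      case 3
      have l: "2 \<le> length lam" using c 3 by simp
      have x: "1 \<le> x 2" "x 2 + 1 \<le> x 1" using x_pos[of 2] x_decreasing[of 1 2] l by auto
      \<comment> \<open>Here \<open>x 1 * x 2 - a 2 = x 2 * (x 1 - x 2 + 1)\<close> cancels, and
        \<open>x 1 + x 2\<close> is \<open>h 1 (r - 1)\<close>. As \<open>h 2 1 = h 2 s = 1\<close>,
        the prefactor reduces to \<open>h 1 s\<close>.\<close>
      have "2 * x 2 * (x 1 - x 2 + 1) * weight 2 = 2 * x 2 * (x 1 - x 2 + 1) * (g 2 * (x 1 + x 2))"
        using weight[of 2] l by (simp add: algebra_simps)
      then have "weight 2 = g 2 * (x 1 + x 2)" using x by simp
      moreover have "h 1 1 = x 1 + x 2" using h_row[of 1 1] l by (simp add: numeral_2_eq_2)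
      moreover have "{1..<2} = {1::nat}" by auto
      ultimately have "h 1 s * of_int (remaining_prod 2 s) * (\<Prod>j\<in>{2..<s}. h 2 j) * (x 1 + x 2) =
          of_int hook_prod * g 2 * (x 1 + x 2)"
        using corner_term[OF rs] 3 by (simp add: mult_ac)
      then have "h 1 s * of_int (remaining_prod 2 s) * (\<Prod>j\<in>{2..<s}. h 2 j) = of_int hook_prod * g 2"
        using x by simp
      then show ?thesis
        using 3 h_outside[of 2 1] h_corner_column[OF rs, of 2] by simp
    next
      case 4
      let ?u1 = "h 1 (r - 1)" and ?v1 = "h 1 s" and ?u2 = "h 2 (r - 1)" and ?v2 = "h 2 s"
      have u: "?u1 = x 1 + x r" "?u2 = x 2 + x r"
        and v: "?v1 = x 1 - x r + 1" "?v2 = x 2 - x r + 1"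
        using h_previous[of 1 r] h_previous[of 2 r] h_corner_column[OF rs, of 1]
          h_corner_column[OF rs, of 2] c 4 by auto
      have pos: "?v1 * ?u1 * (?v2 * ?u2) \<noteq> 0"
        using x_decreasing[of 1 r] x_decreasing[of 2 r] x_pos[of r] c 4 unfolding u v by auto
      have num: "?v1 * ?u2 + (?u1 - 1) * (?v2 - 1) = 2 * (x 1 * x 2 - a r)"
        unfolding u v by (simp add: algebra_simps)
      have l: "2 \<le> length lam" using c 4 by linarith
      have "{1..<r} = insert 1 (insert 2 {3..<r})" and max: "max r 2 = r" using 4 by auto
      then have split: "prod f {1..<r} = f 1 * (f 2 * prod f {3..<r})" for f :: "nat \<Rightarrow> int"
        by simp
      have "of_int (?f r s) * (?v1 * ?u1 * (?v2 * ?u2)) =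
         (?v1 * ?u2 + (?u1 - 1) * (?v2 - 1)) * of_int (remaining_prod r s *
         (\<Prod>i\<in>{1..<r}. hook_len i s) * (\<Prod>j\<in>{r..<s}. hook_len r j) *
         (\<Prod>i\<in>{1..<r}. hook_len i (r - 1)))"
        unfolding split[of "\<lambda>i. hook_len i s"] split[of "\<lambda>i. hook_len i (r - 1)"] max
        by (simp only: of_int_mult of_int_add of_int_diff of_int_1 mult_ac)
      also have "\<dots> = of_int hook_prod * (weight r * (2 * (x 1 * x 2 - a r)))"
        unfolding corner_term[OF rs] num by simp
      also have "\<dots> = (of_int hook_prod * g r) * (?v1 * ?u1 * (?v2 * ?u2))"
        unfolding weight[OF c(1,2) l] u v by (simp only: mult_ac)
      finally show ?thesis using pos by (simp only: mult_cancel_right simp_thms)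
    qed
  qed
  moreover have "g r = 0" if "1 \<le> r" "r < length lam" "x r = x (r + 1) + 1" for r
  \<comment> \<open>For \<open>r = 1\<close> the factor \<open>i = 2\<close> is no longer in the
    product, but \<open>a 1 - x 1 * x 2 = x 1 * (x 1 - 1 - x 2)\<close> vanishes instead.\<close>
  proof (cases "r = 1")
    case True
    then show ?thesis using that by (simp add: g_def numeral_2_eq_2)
  next
    case False
    then show ?thesis using noncorner_prod[of r 3] that by (simp add: g_def)
  qed
  moreover have "(\<Sum>r\<in>?I. g r) = 1"
  proof (cases "length lam = 1")
    case False
    then have l: "2 \<le> length lam" using length_pos by linarith
    \<comment> \<open>Putting the root \<open>x 1 * x 2\<close> at index 2 makes the numerator a
      product over \<open>{2..length lam}\<close>, as \<open>sum_lagrange_monic\<close>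
      expects.\<close>
    define b' where "b' i = (if i = 2 then x 1 * x 2 else b i)" for i
    have "{2..length lam} = insert 2 ?K" using l by auto
    then have "(\<Prod>i\<in>{2..length lam}. a r - b' i) = (a r - x 1 * x 2) * (\<Prod>i\<in>?K. a r - b i)" for r
      by (simp add: b'_def)
    then have "g r = (\<Prod>i\<in>{2..length lam}. a r - b' i) / lagrange_denom r" for r
      using False by (simp add: g_def)
    then show ?thesis
      unfolding lagrange_denom_def
      using l by (simp only:, subst sum_lagrange_monic[OF _ inj_on_a]) auto
  qed (simp add: g_def)
  ultimately have "of_int (\<Sum>(r, s)\<in>shifted_corners lam. ?f r s) = (of_int hook_prod :: rat)"
    using sum_corners[of ?f g] by simp
  then show ?thesis by (simp only: of_int_eq_iff)
qed

end

theorem theorem1: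
  fixes lam :: "nat list" and n :: nat
  assumes "strict_partition lam n"
  shows
   "(int n * (\<Prod>(i, j)\<in>shifted_diagram lam - shifted_corners lam. (shifted_hook_length lam i j - 1)) =
       (\<Sum>(r, s)\<in>shifted_corners lam.
          (\<Prod>(i, j)\<in>{(i, j) \<in> shifted_diagram lam - shifted_corners lam. i \<noteq> r \<and> j \<noteq> r - 1 \<and> j \<noteq> s}.
             (shifted_hook_length lam i j - 1)) *
          (\<Prod>i\<in>{1..<r}. shifted_hook_length lam i s) *
          (\<Prod>j\<in>{r..<s}. shifted_hook_length lam r j) *
          (\<Prod>i\<in>{1..<r}. shifted_hook_length lam i (r - 1))))
    \<and>
    (int (part lam 1) * (\<Prod>(i, j)\<in>shifted_diagram lam - shifted_corners lam. (shifted_hook_length lam i j - 1)) =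
       (\<Sum>(r, s)\<in>shifted_corners lam.
          (shifted_hook_length lam 1 (r - 1) + shifted_hook_length lam 1 s - 1) *
          (\<Prod>(i, j)\<in>{(i, j) \<in> shifted_diagram lam - shifted_corners lam. i \<noteq> r \<and> j \<noteq> r - 1 \<and> j \<noteq> s}.
             (shifted_hook_length lam i j - 1)) *
          (\<Prod>i\<in>{2..<r}. shifted_hook_length lam i s) *
          (\<Prod>j\<in>{r..<s}. shifted_hook_length lam r j) *
          (\<Prod>i\<in>{2..<r}. shifted_hook_length lam i (r - 1))))
    \<and>
    ((\<Prod>(i, j)\<in>shifted_diagram lam - shifted_corners lam. (shifted_hook_length lam i j - 1)) =
       (\<Sum>(r, s)\<in>shifted_corners lam.
          (shifted_hook_length lam 1 s * shifted_hook_length lam 2 (r - 1) +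
             (shifted_hook_length lam 1 (r - 1) - 1) * (shifted_hook_length lam 2 s - 1)) *
          (\<Prod>(i, j)\<in>{(i, j) \<in> shifted_diagram lam - shifted_corners lam. i \<noteq> r \<and> j \<noteq> r - 1 \<and> j \<noteq> s}.
             (shifted_hook_length lam i j - 1)) *
          (\<Prod>i\<in>{3..<r}. shifted_hook_length lam i s) *
          (\<Prod>j\<in>{max r 2..<s}. shifted_hook_length lam r j) *
          (\<Prod>i\<in>{3..<r}. shifted_hook_length lam i (r - 1))))"
proof -
  interpret distinct_parts lam n by (unfold_locales) (rule assms)
  show ?thesis
    using first_identity second_identity third_identity
    unfolding hook_prod_def remaining_prod_def by blast
qed

end
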